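(* The price of anarchy of NOB-feasible pure Nash equilibria in budget-free generalized second-price (GSP) auctions is at least $2$. That is, the supremum of $\mathrm{OPT}(I)/\mathrm{LW}(I,a)$ over all budget-free GSP instances $I$ and all NOB-feasible pure Nash equilibria $a$ of $I$ is at least $2$.
   Context: GSP auction: bidders $N=[n]$, $n\ge2$, and $m\le n$ slots with click-through rates $\alpha_1\ge\alpha_2\ge\dots\ge\alpha_m>0$; set $\alpha_0=0$. Bidder $i$ submits a scalar bid $a_i\ge0$. Bidders are ranked in non-increasing order of bids, ties resolved by a fixed deterministic rule (part of the instance), and slot $j\in[m]$ goes to the $j$-th ranked bidder; $X_i(a)\in\{0,1,\dots,m\}$ is the slot of bidder $i$ ($0$ meaning no slot). Let $\beta_j(a)$ be the $j$-th highest bid, with $\beta_{n+1}(a)=0$. Bidder $i$ pays $P_i(a)=\alpha_{X_i(a)}\beta_{X_i(a)+1}(a)$. Bidder $i$ has a value per click $\bar v_i\ge0$, giving valuation $v_i(j)=\bar v_i\alpha_j$. Budget-free means all budgets are infinite. Utility: $u_i(a)=v_i(X_i(a))-P_i(a)$. A pure Nash equilibrium is a bid profile $a$ with $u_i(a)\ge u_i(a_i',a_{-i})$ for all $i$ and all $a_i'\ge0$. In the budget-free case $\mathrm{LW}(I,a)=\sum_iv_i(X_i(a))$ and $\mathrm{OPT}(I)$ is the maximum of $\sum_iv_i(x_i)$ over $x\in\{0,\dots,m\}^n$ in which no slot $j\ge1$ is assigned to two bidders. NOB (no overbidding): let $W_i(a)=\sup\{P_i(a_i,a_{-i}'):X_i(a_i,a_{-i}')=X_i(a)\}$.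 $a$ is NOB-feasible if $\sum_iW_i(a)\le\mathrm{LW}(I,a)$. Deviations are not restricted by NOB. *)

theory Defs
  imports "HOL-Library.Extended_Real" "HOL-Library.FuncSet"
begin

text \<open>
  Bidders are \<open>{1..n}\<close>, slots are \<open>{1..m}\<close>, and \<open>0\<close> stands for ``no slot''.
  \<open>pos I a i\<close> is the position, in \<open>{1..n}\<close>, of bidder \<open>i\<close> in the ranking of the bid
  profile \<open>a\<close>; the tie-breaking rule of the instance is encoded in this function.
  There are no budget fields: the auctions are budget-free.
\<close>

record gsp =
  bidders :: nat
  slots :: nat
  ctr :: "nat \<Rightarrow> real"
  val :: "nat \<Rightarrow> real"
  pos :: "(nat \<Rightarrow> real) \<Rightarrow> nat \<Rightarrow> nat"

definition players :: "gsp \<Rightarrow> nat set" where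
  "players I = {1..bidders I}"

text \<open>
  Profiles are extensional, so a rule \<open>pos I\<close> can only depend on the bids of the \<open>n\<close> bidders.
\<close>

definition profiles :: "gsp \<Rightarrow> (nat \<Rightarrow> real) set" where
  "profiles I = players I \<rightarrow>\<^sub>E {0..}"

definition gsp_instance :: "gsp \<Rightarrow> bool" where
  "gsp_instance I \<longleftrightarrow>
     2 \<le> bidders I \<and> 1 \<le> slots I \<and> slots I \<le> bidders I \<and>
     ctr I 0 = 0 \<and>
     (\<forall>j\<in>{1..slots I}. 0 < ctr I j) \<and>
     (\<forall>j\<in>{1..slots I}. \<forall>k\<in>{1..slots I}. j \<le> k \<longrightarrow> ctr I k \<le> ctr I j) \<and>
     (\<forall>i\<in>players I. 0 \<le> val I i) \<and>
     (\<forall>a\<in>profiles I. bij_betw (pos I a) (players I) {1..bidders I} \<and>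
        (\<forall>i\<in>players I. \<forall>k\<in>players I. a k < a i \<longrightarrow> pos I a i < pos I a k))"

definition slot_of :: "gsp \<Rightarrow> (nat \<Rightarrow> real) \<Rightarrow> nat \<Rightarrow> nat" where
  "slot_of I a i = (if pos I a i \<le> slots I then pos I a i else 0)"

definition nth_highest_bid :: "gsp \<Rightarrow> (nat \<Rightarrow> real) \<Rightarrow> nat \<Rightarrow> real" where
  "nth_highest_bid I a j =
     (if j \<in> {1..bidders I} then rev (sort (map a [1..<Suc (bidders I)])) ! (j - 1) else 0)"

definition payment :: "gsp \<Rightarrow> (nat \<Rightarrow> real) \<Rightarrow> nat \<Rightarrow> real" where
  "payment I a i = ctr I (slot_of I a i) * nth_highest_bid I a (slot_of I a i + 1)"

definition valuation :: "gsp \<Rightarrow> nat \<Rightarrow> nat \<Rightarrow> real" where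
  "valuation I i j = val I i * ctr I j"

definition utility :: "gsp \<Rightarrow> (nat \<Rightarrow> real) \<Rightarrow> nat \<Rightarrow> real" where
  "utility I a i = valuation I i (slot_of I a i) - payment I a i"

definition pure_nash :: "gsp \<Rightarrow> (nat \<Rightarrow> real) \<Rightarrow> bool" where
  "pure_nash I a \<longleftrightarrow> a \<in> profiles I \<and>
     (\<forall>i\<in>players I. \<forall>b\<ge>0. utility I (a(i := b)) i \<le> utility I a i)"

text \<open>Liquid welfare; with infinite budgets it is the social welfare.\<close>

definition LW :: "gsp \<Rightarrow> (nat \<Rightarrow> real) \<Rightarrow> real" where
  "LW I a = (\<Sum>i\<in>players I. valuation I i (slot_of I a i))"

definition allocations :: "gsp \<Rightarrow> (nat \<Rightarrow> nat) set" where
  "allocations I = {x \<in> players I \<rightarrow>\<^sub>E {0..slots I}.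
     \<forall>i\<in>players I. \<forall>k\<in>players I. i \<noteq> k \<and> 1 \<le> x i \<longrightarrow> x i \<noteq> x k}"

definition OPT :: "gsp \<Rightarrow> real" where
  "OPT I = Max ((\<lambda>x. \<Sum>i\<in>players I. valuation I i (x i)) ` allocations I)"

text \<open>
  In \<open>worst_payment\<close> the bids \<open>a'\<close> of the other bidders vary while \<open>i\<close> keeps the bid \<open>a i\<close>
  and the slot it has under \<open>a\<close>.
\<close>

definition worst_payment :: "gsp \<Rightarrow> (nat \<Rightarrow> real) \<Rightarrow> nat \<Rightarrow> ereal" where
  "worst_payment I a i =
     (SUP a' \<in> {a' \<in> profiles I. slot_of I (a'(i := a i)) i = slot_of I a i}.
        ereal (payment I (a'(i := a i)) i))"

definition nob_feasible :: "gsp \<Rightarrow> (nat \<Rightarrow> real) \<Rightarrow> bool" where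
  "nob_feasible I a \<longleftrightarrow> (\<Sum>i\<in>players I. worst_payment I a i) \<le> ereal (LW I a)"

text \<open>
  In \<^typ>\<open>ereal\<close>, \<open>x / 0 = \<infinity>\<close> for \<open>x > 0\<close> and \<open>0 / 0 = 0\<close>. The first case does not occur here:
  if a NOB-feasible equilibrium had liquid welfare \<open>0\<close>, then all bids in the first \<open>n - 1\<close>
  positions that win a slot would be \<open>0\<close>, hence the first slot would be free to every bidder,
  and a bidder of positive value would deviate to it. The second case is the instance with all
  values \<open>0\<close>, whose contribution \<open>0\<close> does not affect the supremum exceeding a positive bound.
\<close>

definition nob_price_of_anarchy :: ereal where
  "nob_price_of_anarchy =
     (SUP (I, a) \<in> {(I, a). gsp_instance I \<and> pure_nash I a \<and> nob_feasible I a}.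
        ereal (OPT I) / ereal (LW I a))"

end

theory Submission imports Defs begin

text \<open>
  A two-bidder, two-slot instance attains the ratio \<open>2\<close>. The click-through rates are \<open>1\<close> and
  \<open>1/2\<close>; the bidder of value \<open>1\<close> bids \<open>0\<close> and takes the second slot, and the bidder of value
  \<open>0\<close> bids \<open>1/2\<close> and takes the first slot for free. Both slots give the first bidder utility
  \<open>1/2\<close>, so the profile is an equilibrium. The last slot is always free, so only the bid
  \<open>1/2\<close> on the first slot counts as worst-case payment, and it equals the welfare \<open>1/2\<close>.
\<close>

definition bad_gsp :: gsp where
  "bad_gsp = \<lparr>bidders = 2, slots = 2,
     ctr = (\<lambda>j. if j = 1 then 1 else if j = 2 then 1/2 else 0),
     val = (\<lambda>i. if i = 1 then 1 else 0),
     pos = (\<lambda>a i. if a 2 < a 1 then i else 3 - i)\<rparr>"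

definition bad_bids :: "nat \<Rightarrow> real" where
  "bad_bids = (\<lambda>i. if i = 1 then 0 else if i = 2 then 1/2 else undefined)"

lemma players_bad_gsp: "players bad_gsp = {1, 2}"
  by (auto simp: players_def bad_gsp_def)

lemma bad_bids_in_profiles: "bad_bids \<in> profiles bad_gsp"
  by (auto simp: profiles_def players_bad_gsp bad_bids_def PiE_def extensional_def)

lemma gsp_instance_bad_gsp: "gsp_instance bad_gsp"
proof -
  have interval: "{1..bidders bad_gsp} = {1, 2}"
    by (auto simp: bad_gsp_def)
  have "bij_betw (pos bad_gsp a) {1, 2} {1, 2}" for a
    by (auto simp: bij_betw_def inj_on_def bad_gsp_def)
  then show ?thesis
    unfolding gsp_instance_def players_bad_gsp interval
    by (auto simp: bad_gsp_def)
qed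

text \<open>With two slots for two bidders nobody is left at slot \<open>0\<close>. The swap
  \<open>3 - i\<close> sends ties to bidder 2.\<close>

lemma slot_of_bad_gsp:
  assumes "i \<in> {1, 2}"
  shows "slot_of bad_gsp a i = (if a 2 < a 1 then i else 3 - i)"
  using assms by (auto simp: slot_of_def bad_gsp_def)

text \<open>These are the prices per click of slots 1 and 2. The second is the out-of-range default,
  which makes the last slot free.\<close>

lemma nth_highest_bid_bad_gsp:
  "nth_highest_bid bad_gsp a 2 = min (a 1) (a 2)"
  "nth_highest_bid bad_gsp a 3 = 0"
  by (auto simp: nth_highest_bid_def bad_gsp_def upt_rec min_def numeral_2_eq_2)

lemma payment_bad_gsp:
  assumes "i \<in> {1, 2}"
  shows "payment bad_gsp a i = (if slot_of bad_gsp a i = 1 then min (a 1) (a 2) else 0)"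
  using assms nth_highest_bid_bad_gsp[of a]
  by (auto simp: payment_def slot_of_bad_gsp numeral_3_eq_3 numeral_2_eq_2)
     (auto simp: bad_gsp_def)

lemma valuation_bad_gsp:
  "valuation bad_gsp i j =
     (if i = 1 then if j = 1 then 1 else if j = 2 then 1/2 else 0 else 0)"
  by (simp add: valuation_def bad_gsp_def)

text \<open>Bidder 2 has value 0, so no deviation brings it more than its present utility 0.\<close>

lemma pure_nash_bad_bids: "pure_nash bad_gsp bad_bids"
  unfolding pure_nash_def players_bad_gsp
  using bad_bids_in_profiles
  by (auto simp: utility_def valuation_bad_gsp payment_bad_gsp slot_of_bad_gsp bad_bids_def)

lemma LW_bad_bids: "LW bad_gsp bad_bids = 1/2"
  by (simp add: LW_def players_bad_gsp valuation_bad_gsp slot_of_bad_gsp bad_bids_def)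

text \<open>The price of slot 1 is the smaller bid, hence at most the fixed bid of its holder. Upper
  bounds on the suprema suffice.\<close>

lemma worst_payment_bad_bids:
  "worst_payment bad_gsp bad_bids 1 \<le> 0"
  "worst_payment bad_gsp bad_bids 2 \<le> ereal (1/2)"
  unfolding worst_payment_def
  by (rule SUP_least,
      auto simp: payment_bad_gsp slot_of_bad_gsp bad_bids_def split: if_splits)+

lemma nob_feasible_bad_bids: "nob_feasible bad_gsp bad_bids"
  using add_mono[OF worst_payment_bad_bids]
  by (simp add: nob_feasible_def players_bad_gsp LW_bad_bids)

lemma finite_allocations: "finite (allocations I)"
proof (rule finite_subset)
  show "allocations I \<subseteq> players I \<rightarrow>\<^sub>E {0..slots I}"
    by (auto simp: allocations_def)
qed (simp add: finite_PiE players_def)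

lemma OPT_ge:
  assumes "x \<in> allocations I"
  shows "(\<Sum>i\<in>players I. valuation I i (x i)) \<le> OPT I"
  using assms by (simp add: OPT_def finite_allocations)

lemma OPT_bad_gsp_ge: "1 \<le> OPT bad_gsp"
proof -
  \<comment> \<open>The efficient assignment: the only bidder with positive value gets the better
    slot.\<close>
  let ?x = "\<lambda>i\<in>{1, 2::nat}. i"
  have "?x \<in> allocations bad_gsp"
    unfolding allocations_def players_bad_gsp by (auto simp: bad_gsp_def)
  from OPT_ge[OF this] show ?thesis
    by (simp add: players_bad_gsp valuation_bad_gsp)
qed

theorem proposition6p1: "nob_price_of_anarchy \<ge> 2"
proof -
  have "(2::ereal) \<le> ereal (OPT bad_gsp) / ereal (LW bad_gsp bad_bids)"
    using OPT_bad_gsp_ge by (simp add: LW_bad_bids)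
  also have "\<dots> \<le> nob_price_of_anarchy"
    unfolding nob_price_of_anarchy_def
    using gsp_instance_bad_gsp pure_nash_bad_bids nob_feasible_bad_bids
    by (intro SUP_upper2[of "(bad_gsp, bad_bids)"]) auto
  finally show ?thesis .
qed

end
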